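(* Let $(b_n)_{n\ge 1}$ be a probability distribution on the positive integers (i.e. $b_n\ge 0$, $\sum_{n\ge1}b_n=1$), let $0<b<1$ with $b_1\ge b$, and suppose that for some $r>1$ we have $b(r)=\sum_{n=1}^\infty b_n r^n<\infty$. Let $(u_n)_{n\ge0}$ be the renewal sequence of $(b_n)$ and $u_\infty=\lim_{n\to\infty}u_n$. Then $$u_\infty=\Big(\sum_{n=1}^\infty n b_n\Big)^{-1}$$ and $$\sup_{|z|=r}\Big|\sum_{n=0}^\infty (u_n-u_\infty)z^n\Big|\le \frac{c(r)-c(1)}{c(1)(r-1)\,[(1-b)D(\alpha)-c(r)+c(1)]_+},$$ where $c(r)=\frac{b(r)-1}{r-1}$, $c(1)=u_\infty^{-1}=\sum_{n\ge1}nb_n$, and $$D(\alpha)=\frac{\big|1+\frac{b}{1-b}\big(1-e^{\frac{i\pi}{1+\alpha}}\big)\big|-1}{\big|1-e^{\frac{i\pi}{1+\alpha}}\big|},\qquad \alpha=\frac{c(1)-1}{1-b}.$$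
   Context: The renewal sequence of $(b_n)_{n\ge1}$ is defined by $u_0=1$ and $u_n=\sum_{k=1}^n u_{n-k}b_k$ for $n\ge1$. $[x]_+=\max\{x,0\}$; when the factor $[\cdot]_+$ in the denominator is $0$ the right-hand side is read as $+\infty$. *)

theory Defs
  imports "HOL-Analysis.Analysis"
begin

text \<open>Sequences indexed by the positive integers are functions on \<^typ>\<open>nat\<close> whose value at
  \<open>0\<close> is never used: sums over \<open>n \<ge> 1\<close> are written as series in \<open>b (Suc n)\<close>.\<close>

definition pos_distribution :: "(nat \<Rightarrow> real) \<Rightarrow> bool" where
  "pos_distribution b \<longleftrightarrow> (\<forall>n\<ge>1. 0 \<le> b n) \<and> (\<lambda>n. b (Suc n)) sums 1"

fun renewal :: "(nat \<Rightarrow> real) \<Rightarrow> nat \<Rightarrow> real" where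
  "renewal b 0 = 1"
| "renewal b (Suc n) = (\<Sum>k=1..Suc n. renewal b (Suc n - k) * b k)"

definition gen_fun :: "(nat \<Rightarrow> real) \<Rightarrow> real \<Rightarrow> real" where
  "gen_fun b r = (\<Sum>n. b (Suc n) * r ^ Suc n)"

definition mean :: "(nat \<Rightarrow> real) \<Rightarrow> real" where
  "mean b = (\<Sum>n. real (Suc n) * b (Suc n))"

text \<open>The quotient \<open>c(r) = (b(r) - 1) / (r - 1)\<close> is used for \<open>r > 1\<close> only; its value \<open>c(1)\<close>
  is \<^term>\<open>mean b\<close>.\<close>

definition c_fun :: "(nat \<Rightarrow> real) \<Rightarrow> real \<Rightarrow> real" where
  "c_fun b r = (gen_fun b r - 1) / (r - 1)"

text \<open>In the following definitions the real number \<open>\<beta>\<close> is the lower bound for \<open>b 1\<close>.\<close>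

definition alpha :: "(nat \<Rightarrow> real) \<Rightarrow> real \<Rightarrow> real" where
  "alpha b \<beta> = (mean b - 1) / (1 - \<beta>)"

definition D_fun :: "real \<Rightarrow> real \<Rightarrow> real" where
  "D_fun \<beta> a =
     (cmod (1 + of_real (\<beta> / (1 - \<beta>)) * (1 - exp (\<i> * of_real (pi / (1 + a))))) - 1)
       / cmod (1 - exp (\<i> * of_real (pi / (1 + a))))"

definition gap :: "(nat \<Rightarrow> real) \<Rightarrow> real \<Rightarrow> real \<Rightarrow> real" where
  "gap b \<beta> r = max ((1 - \<beta>) * D_fun \<beta> (alpha b \<beta>) - c_fun b r + mean b) 0"

text \<open>The explicit case distinction fixes the value of the bound to be \<open>\<infinity>\<close> when the positive
  part in the denominator vanishes, whatever the numerator.\<close>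

definition renewal_bound :: "(nat \<Rightarrow> real) \<Rightarrow> real \<Rightarrow> real \<Rightarrow> ereal" where
  "renewal_bound b \<beta> r =
     (if gap b \<beta> r = 0 then \<infinity>
      else ereal ((c_fun b r - mean b) / (mean b * (r - 1) * gap b \<beta> r)))"

end

theory Submission imports Defs "HOL-Complex_Analysis.Complex_Analysis" begin

text \<open>
  Write \<open>b(z) = \<Sum> b\<^sub>n z\<^sup>n\<close>, let \<open>t\<^sub>n = \<Sum>\<^sub>k\<^sub>>\<^sub>n b\<^sub>k\<close> be the tails of the distribution and
  \<open>h\<^sub>n = \<Sum>\<^sub>k\<^sub>>\<^sub>n t\<^sub>k\<close> the tails of the tails, with generating functions \<open>c(z) = (b(z) - 1) / (z - 1)\<close>
  and \<open>h(z) = (c(z) - c(1)) / (z - 1)\<close>. Since \<open>\<Sum> u\<^sub>n z\<^sup>n = 1 / (1 - b(z))\<close>, the series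
  \<open>w(z) = \<Sum> (u\<^sub>n - 1/c(1)) z\<^sup>n\<close> satisfies \<open>c(1) c(z) w(z) = h(z)\<close> (lemma \<open>fps_identity\<close>).
  All \<open>h\<^sub>n\<close> are nonnegative, so \<open>\<bar>h(z)\<bar> \<le> h(r) = (c(r) - c(1)) / (r - 1)\<close> on \<open>\<bar>z\<bar> = r\<close>, and
  everything rests on a lower bound for \<open>\<bar>c(z)\<bar>\<close>.

  Such a bound is first obtained on the unit circle: \<open>\<bar>c(e\<^sup>i\<^sup>x)\<bar> \<ge> (1 - \<beta>) D(\<alpha>)\<close>
  (lemma \<open>circle_bound\<close>). After rotation by a suitable angle \<open>\<sigma>\<close> only the imaginary part of
  \<open>c(e\<^sup>i\<^sup>x)\<close> matters, which is a sum of cosines weighted by the \<open>b\<^sub>n\<close>. The term \<open>n = 1\<close> contributes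
  \<open>sin \<sigma>\<close>, and the negative contributions of the other terms are limited by their total weight
  \<open>1 - b\<^sub>1 \<le> 1 - \<beta>\<close>. With \<open>y = \<pi>/(1 + \<alpha>)\<close> this suffices for \<open>x \<ge> y\<close>. For \<open>x < y\<close> the cosine
  terms with \<open>(n - 1) x \<le> \<pi> - y\<close> are harmless, and Markov's inequality bounds the weight of the
  remaining ones by \<open>(1 - \<beta>) x/y\<close>, which is what \<open>D(\<alpha>)\<close> permits. Moving outwards from the unit circle
  to the circle of radius \<open>r\<close> changes \<open>c\<close> by at most \<open>\<Sum> t\<^sub>n (r\<^sup>n - 1) = c(r) - c(1)\<close>, so the
  denominator of the asserted bound is a lower bound for \<open>\<bar>c\<bar>\<close> on \<open>1 \<le> \<bar>z\<bar> \<le> r\<close>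
  (lemma \<open>annulus_bound\<close>).

  Convergence of the series for \<open>w\<close> on the circle \<open>\<bar>z\<bar> = r\<close> itself does not follow from
  holomorphy in the open disc. It is a consequence of Wiener's lemma for power series: if the
  coefficients of \<open>f\<close> are absolutely summable and \<open>f\<close> has no zero on the closed unit disc, then
  the coefficients of \<open>1/f\<close> are absolutely summable (lemma \<open>l1_inverse\<close>). It is applied to
  \<open>z \<mapsto> c(rz)\<close>. Applied to \<open>c\<close> it shows that \<open>\<Sum> \<bar>u\<^sub>n - 1/c(1)\<bar>\<close> is finite, and thus that
  \<open>u\<^sub>n\<close> tends to \<open>1/c(1)\<close> whether or not the gap is positive.
\<close>

section \<open>Power series with absolutely summable coefficients\<close>

definition l1 :: "complex fps \<Rightarrow> bool" where
  "l1 F \<longleftrightarrow> summable (\<lambda>n. norm (fps_nth F n))"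

definition l1_norm :: "complex fps \<Rightarrow> real" where
  "l1_norm F = (\<Sum>n. norm (fps_nth F n))"

lemma l1_norm_nonneg: "l1 F \<Longrightarrow> 0 \<le> l1_norm F"
  by (simp add: l1_def l1_norm_def suminf_nonneg)

lemma l1_bound:
  assumes "\<And>n. norm (fps_nth F n) \<le> B n" and "B sums S"
  shows "l1 F" "l1_norm F \<le> S"
proof -
  have "summable B" using assms(2) by (rule sums_summable)
  then show 1: "l1 F"
    unfolding l1_def by (rule summable_comparison_test'[where N = 0]) (simp add: assms(1))
  have "l1_norm F \<le> (\<Sum>n. B n)"
    unfolding l1_norm_def using 1 \<open>summable B\<close> by (intro suminf_le assms(1)) (simp_all add: l1_def)
  then show "l1_norm F \<le> S" using assms(2) by (simp add: sums_iff)
qed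

lemma l1_one: "l1 1" and l1_norm_one: "l1_norm 1 = 1"
proof -
  have "(\<lambda>n. norm (fps_nth (1::complex fps) n)) sums (\<Sum>n\<in>{0}. norm (fps_nth (1::complex fps) n))"
    by (rule sums_finite) auto
  then show "l1 1" "l1_norm 1 = 1" by (auto simp: l1_def l1_norm_def sums_iff)
qed

lemma l1_add: "l1 F \<Longrightarrow> l1 G \<Longrightarrow> l1 (F + G)"
  unfolding l1_def
  by (rule summable_comparison_test'[where N = 0 and g = "\<lambda>n. norm (fps_nth F n) + norm (fps_nth G n)"])
    (auto intro: summable_add norm_triangle_ineq)

lemma l1_mult:
  assumes "l1 F" "l1 G"
  shows "l1 (F * G)" "l1_norm (F * G) \<le> l1_norm F * l1_norm G"
proof -
  have s: "(\<lambda>n. \<Sum>i\<le>n. norm (fps_nth F i) * norm (fps_nth G (n - i)))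
      sums (l1_norm F * l1_norm G)"
    unfolding l1_norm_def using assms by (intro Cauchy_product_sums) (simp_all add: l1_def)
  have b: "norm (fps_nth (F * G) n) \<le> (\<Sum>i\<le>n. norm (fps_nth F i) * norm (fps_nth G (n - i)))"
    for n
    unfolding fps_mult_nth atLeast0AtMost by (rule sum_norm_le) (simp add: norm_mult)
  show "l1 (F * G)" "l1_norm (F * G) \<le> l1_norm F * l1_norm G"
    using l1_bound[OF b s] by auto
qed

lemma l1_power:
  assumes "l1 F"
  shows "l1 (F ^ n) \<and> l1_norm (F ^ n) \<le> l1_norm F ^ n"
proof (induction n)
  case (Suc n)
  then show ?case
    using l1_mult[OF assms, of "F ^ n"] l1_norm_nonneg[OF assms]
      mult_left_mono[of "l1_norm (F ^ n)" "l1_norm F ^ n" "l1_norm F"] by auto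
qed (simp add: l1_one l1_norm_one)

lemma l1_sum: "(\<And>i. i \<in> I \<Longrightarrow> l1 (F i)) \<Longrightarrow> l1 (\<Sum>i\<in>I. F i)"
proof (induction I rule: infinite_finite_induct)
  case (insert x I)
  then show ?case by (simp add: l1_add)
qed (simp_all add: l1_def)

text \<open>The inverse \<open>Y\<close> exists as a formal power series and satisfies \<open>Y = 1 + X Y\<close>. Hence every
  partial sum \<open>S\<close> of the absolute values of its coefficients satisfies \<open>S \<le> 1 + \<parallel>X\<parallel> S\<close>, which
  bounds \<open>S\<close> without any convergence argument for the geometric series.\<close>

lemma l1_inverse_one_minus:
  assumes X: "l1 X" and less: "l1_norm X < 1"
  shows "l1 (inverse (1 - X))"
proof -
  define Y where "Y = inverse (1 - X)"
  define S where "S N = (\<Sum>n\<le>N. norm (fps_nth Y n))" for N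
  have sX: "summable (\<lambda>n. norm (fps_nth X n))" using X by (simp add: l1_def)
  have le_norm: "(\<Sum>n\<le>N. norm (fps_nth X n)) \<le> l1_norm X" for N
    unfolding l1_norm_def by (rule sum_le_suminf[OF sX]) auto
  have "norm (fps_nth X 0) < 1" using le_norm[of 0] less by simp
  then have "fps_nth (1 - X) 0 \<noteq> 0" by auto
  then have "(1 - X) * Y = 1" unfolding Y_def by (simp add: inverse_mult_eq_1')
  then have "Y - X * Y = 1" by (simp only: left_diff_distrib mult_1)
  then have Y: "Y = 1 + X * Y" by (simp only: diff_eq_eq)
  have bound: "S N \<le> 1 + l1_norm X * S N" for N
  proof -
    have "S N = (\<Sum>n\<le>N. norm (fps_nth (1 + X * Y) n))" unfolding S_def by (simp flip: Y)
    also have "\<dots> \<le> (\<Sum>n\<le>N. norm (fps_nth (1::complex fps) n)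
        + (\<Sum>i\<le>n. norm (fps_nth X i) * norm (fps_nth Y (n - i))))"
      unfolding fps_add_nth fps_mult_nth atLeast0AtMost
      by (intro sum_mono order_trans[OF norm_triangle_ineq] add_left_mono sum_norm_le)
        (simp add: norm_mult)
    also have "\<dots> = 1 + (\<Sum>n\<le>N. \<Sum>i\<le>n. norm (fps_nth X i) * norm (fps_nth Y (n - i)))"
    proof -
      have "(\<Sum>n\<le>N. norm (fps_nth (1::complex fps) n))
          = (\<Sum>n\<in>{0}. norm (fps_nth (1::complex fps) n))"
        by (rule sum.mono_neutral_right) auto
      then show ?thesis by (simp add: sum.distrib)
    qed
    also have "(\<Sum>n\<le>N. \<Sum>i\<le>n. norm (fps_nth X i) * norm (fps_nth Y (n - i)))
        = (\<Sum>(i, j)\<in>{(i, j). i + j \<le> N}. norm (fps_nth X i) * norm (fps_nth Y j))"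
      by (rule sum.triangle_reindex_eq[symmetric])
    also have "\<dots> \<le> (\<Sum>(i, j)\<in>{..N} \<times> {..N}. norm (fps_nth X i) * norm (fps_nth Y j))"
      by (rule sum_mono2) auto
    also have "\<dots> = (\<Sum>i\<le>N. norm (fps_nth X i)) * S N"
      unfolding S_def sum_product sum.cartesian_product ..
    also have "\<dots> \<le> l1_norm X * S N"
      by (rule mult_right_mono[OF le_norm]) (simp add: S_def sum_nonneg)
    finally show ?thesis by simp
  qed
  have "S N \<le> 1 / (1 - l1_norm X)" for N
  proof -
    have "S N * (1 - l1_norm X) \<le> 1" using bound[of N] by (simp add: algebra_simps)
    then show ?thesis using less by (simp add: pos_le_divide_eq)
  qed
  then have "(\<Sum>n\<le>N. norm (fps_nth Y n)) \<le> 1 / (1 - l1_norm X)" for N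
    unfolding S_def .
  then have "summable (\<lambda>n. norm (fps_nth Y n))"
    by (rule bounded_imp_summable[rotated]) simp
  then show ?thesis by (simp add: l1_def Y_def)
qed

lemma norm_mult_power_le:
  fixes a z :: complex
  assumes "norm z \<le> 1"
  shows "norm (a * z ^ n) \<le> norm a"
  using mult_left_mono[OF power_le_one[OF norm_ge_zero assms, of n] norm_ge_zero[of a]]
  by (simp add: norm_mult norm_power)

lemma l1_eval_sums:
  assumes "l1 F" "norm z \<le> 1"
  shows "summable (\<lambda>n. norm (fps_nth F n * z ^ n))"
proof (rule summable_comparison_test'[where N = 0])
  show "summable (\<lambda>n. norm (fps_nth F n))" using assms(1) by (simp only: l1_def)
  show "norm (norm (fps_nth F n * z ^ n)) \<le> norm (fps_nth F n)" for n
    using norm_mult_power_le[OF assms(2)] by simp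
qed

lemma eval_fps_mult_l1:
  assumes "l1 F" "l1 G" "norm z \<le> 1"
  shows "eval_fps (F * G) z = eval_fps F z * eval_fps G z"
proof -
  have "(\<Sum>i\<le>n. (fps_nth F i * z ^ i) * (fps_nth G (n - i) * z ^ (n - i)))
      = fps_nth (F * G) n * z ^ n" for n
  proof -
    have "(fps_nth F i * z ^ i) * (fps_nth G (n - i) * z ^ (n - i))
        = fps_nth F i * fps_nth G (n - i) * z ^ n" if "i \<le> n" for i
    proof -
      have "z ^ n = z ^ i * z ^ (n - i)" using that by (simp flip: power_add)
      then show ?thesis by (simp only: ac_simps)
    qed
    then show ?thesis
      unfolding fps_mult_nth atLeast0AtMost sum_distrib_right by (intro sum.cong) auto
  qed
  then have "eval_fps F z * eval_fps G z = (\<Sum>n. fps_nth (F * G) n * z ^ n)"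
    unfolding eval_fps_def
    using Cauchy_product[OF l1_eval_sums[OF assms(1,3)] l1_eval_sums[OF assms(2,3)]]
    by (simp only:)
  then show ?thesis by (simp only: eval_fps_def)
qed

lemma continuous_on_eval_fps_l1:
  assumes "l1 F"
  shows "continuous_on (cball 0 1) (eval_fps F)"
proof -
  have "uniform_limit (cball 0 1) (\<lambda>n z. \<Sum>k<n. fps_nth F k * z ^ k)
      (\<lambda>z. \<Sum>k. fps_nth F k * z ^ k) sequentially"
  proof (rule Weierstrass_m_test)
    show "norm (fps_nth F n * z ^ n) \<le> norm (fps_nth F n)" if "z \<in> cball 0 1" for n z
      using that by (intro norm_mult_power_le) simp
  qed (use assms in \<open>simp add: l1_def\<close>)
  then have "continuous_on (cball 0 1) (\<lambda>z. \<Sum>k. fps_nth F k * z ^ k)"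
    by (rule uniform_limit_theorem[rotated]) (simp_all add: continuous_on_sum
        continuous_on_mult continuous_on_power continuous_on_id continuous_on_const)
  then show ?thesis by (simp add: eval_fps_def[abs_def])
qed

lemma l1_conv_radius:
  assumes "l1 F"
  shows "1 \<le> fps_conv_radius F"
proof -
  have "summable (\<lambda>n. fps_nth F n * 1 ^ n)"
    by (rule summable_norm_cancel) (use assms in \<open>simp add: l1_def\<close>)
  from conv_radius_geI[OF this] show ?thesis
    by (simp add: fps_conv_radius_def one_ereal_def)
qed

text \<open>Cauchy's inequality on the unit circle, where \<open>1/f\<close> is at most \<open>1/g\<close>. No constant
  accompanies the power of \<open>1/g\<close>, so that high powers of \<open>1/f\<close> can be controlled.\<close>

lemma norm_coeff_inverse_power_le:
  assumes F: "l1 F" and g: "0 < g" and lower: "\<And>z. norm z \<le> 1 \<Longrightarrow> g \<le> norm (eval_fps F z)"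
  shows "norm (fps_nth (inverse F ^ N) k) \<le> (1 / g) ^ N"
proof -
  have F0: "fps_nth F 0 \<noteq> 0" using lower[of 0] g by (auto simp: eval_fps_at_0)
  have rad: "1 \<le> fps_conv_radius F" by (rule l1_conv_radius[OF F])
  let ?f = "\<lambda>z. inverse (eval_fps F z) ^ N"
  have "eval_fps F has_fps_expansion F"
    using rad by (intro eval_fps_has_fps_expansion less_le_trans[OF _ rad]) simp
  then have exp: "?f has_fps_expansion inverse F ^ N"
    by (intro fps_expansion_intros F0)
  have nz: "eval_fps F z \<noteq> 0" if "norm z \<le> 1" for z using lower[OF that] g by auto
  have "norm (fps_nth (inverse F ^ N) k) = norm ((deriv ^^ k) ?f 0) / fact k"
    unfolding fps_nth_fps_expansion[OF exp] by (simp add: norm_divide)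
  also have "\<dots> \<le> (fact k * (1 / g) ^ N / 1 ^ k) / fact k"
  proof (intro divide_right_mono Cauchy_inequality)
    have "eval_fps F holomorphic_on ball 0 1"
    proof (rule holomorphic_on_eval_fps, rule subsetI)
      fix z :: complex assume "z \<in> ball 0 1"
      then have "ereal (norm z) < 1" by (simp add: one_ereal_def)
      then have "ereal (norm z) < fps_conv_radius F" using rad by (rule less_le_trans)
      then show "z \<in> eball 0 (fps_conv_radius F)" by (simp add: in_eball_iff)
    qed
    then show "?f holomorphic_on ball 0 1"
      by (intro holomorphic_on_power holomorphic_on_inverse) (auto intro!: nz)
    show "continuous_on (cball 0 1) ?f"
      by (intro continuous_on_power continuous_on_inverse continuous_on_eval_fps_l1[OF F])
        (auto intro!: nz)
    show "norm (?f z) \<le> (1 / g) ^ N" if "norm (0 - z) = 1" for z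
      unfolding norm_power norm_inverse inverse_eq_divide[symmetric]
      using lower[of z] that g by (intro power_mono le_imp_inverse_le) auto
  qed auto
  finally show ?thesis by simp
qed

text \<open>The formal counterpart of passing from \<open>f(z)\<close> to \<open>f(\<rho> z)\<close>.\<close>

definition dilate :: "real \<Rightarrow> complex fps \<Rightarrow> complex fps" where
  "dilate \<rho> F = fps_compose F (fps_const (of_real \<rho>) * fps_X)"

lemma dilate_nth [simp]: "fps_nth (dilate \<rho> F) n = of_real (\<rho> ^ n) * fps_nth F n"
  by (simp add: dilate_def)

lemma dilate_mult: "dilate \<rho> (F * G) = dilate \<rho> F * dilate \<rho> G"
  unfolding dilate_def by (rule fps_compose_mult_distrib) simp

lemma dilate_power: "dilate \<rho> (F ^ n) = dilate \<rho> F ^ n"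
  unfolding dilate_def by (rule fps_compose_power[symmetric]) simp

lemma dilate_one [simp]: "dilate \<rho> 1 = 1"
  by (simp add: fps_eq_iff)

text \<open>The distance is at most \<open>\<Sum> \<bar>f\<^sub>n\<bar> (1 - \<rho>\<^sup>n)\<close>, which tends to \<open>0\<close> as \<open>\<rho>\<close> increases to \<open>1\<close>:
  the series with coefficients \<open>\<bar>f\<^sub>n\<bar>\<close> is continuous on the closed disc, in particular at \<open>1\<close>.\<close>

lemma dilate_close:
  assumes F: "l1 F" and e: "0 < e"
  shows "\<exists>\<rho>. 0 \<le> \<rho> \<and> \<rho> < 1 \<and> l1 (dilate \<rho> F - F) \<and> l1_norm (dilate \<rho> F - F) \<le> e"
proof -
  define G where "G = Abs_fps (\<lambda>n. complex_of_real (norm (fps_nth F n)))"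
  have G: "l1 G" using F by (simp add: l1_def G_def)
  obtain d where d: "0 < d"
      "\<And>z. z \<in> cball 0 1 \<Longrightarrow> dist z 1 < d \<Longrightarrow> dist (eval_fps G z) (eval_fps G 1) < e"
    using continuous_on_eval_fps_l1[OF G] e by (force simp: continuous_on_iff)
  define \<rho> where "\<rho> = max 0 (1 - d / 2)"
  have \<rho>: "0 \<le> \<rho>" "\<rho> < 1" "1 - \<rho> < d" using d(1) by (auto simp: \<rho>_def)
  have eval: "(\<lambda>n. norm (fps_nth F n) * x ^ n) sums Re (eval_fps G (of_real x))"
    if "0 \<le> x" "x \<le> 1" for x
  proof -
    have "summable (\<lambda>n. fps_nth G n * of_real x ^ n)"
      by (rule summable_norm_cancel, rule l1_eval_sums[OF G]) (use that in simp)
    then have "(\<lambda>n. fps_nth G n * of_real x ^ n) sums eval_fps G (of_real x)"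
      unfolding eval_fps_def by (rule summable_sums)
    then have "(\<lambda>n. Re (fps_nth G n * of_real x ^ n)) sums Re (eval_fps G (of_real x))"
      by (rule sums_Re)
    then show ?thesis unfolding G_def fps_nth_Abs_fps
      by (simp only: of_real_power[symmetric] of_real_mult[symmetric] Re_complex_of_real)
  qed
  have "(\<lambda>n. norm (fps_nth F n) * 1 ^ n - norm (fps_nth F n) * \<rho> ^ n)
      sums (Re (eval_fps G (of_real 1)) - Re (eval_fps G (of_real \<rho>)))"
    using \<rho> by (intro sums_diff eval) auto
  then have s: "(\<lambda>n. norm (fps_nth F n) * (1 - \<rho> ^ n))
      sums (Re (eval_fps G 1) - Re (eval_fps G (of_real \<rho>)))"
    by (simp add: algebra_simps)
  have b: "norm (fps_nth (dilate \<rho> F - F) n) \<le> norm (fps_nth F n) * (1 - \<rho> ^ n)" for n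
  proof -
    have "fps_nth (dilate \<rho> F - F) n = - (of_real (1 - \<rho> ^ n) * fps_nth F n)"
      by (simp add: algebra_simps)
    then have "norm (fps_nth (dilate \<rho> F - F) n) = \<bar>1 - \<rho> ^ n\<bar> * norm (fps_nth F n)"
      by (simp only: norm_minus_cancel norm_mult norm_of_real)
    then show ?thesis using \<rho> by (simp add: power_le_one mult.commute)
  qed
  have "dist (eval_fps G (of_real \<rho>)) (eval_fps G 1) < e"
  proof (rule d(2))
    have "dist (complex_of_real \<rho>) 1 = \<bar>\<rho> - 1\<bar>"
      unfolding dist_norm by (metis norm_of_real of_real_1 of_real_diff)
    then show "dist (complex_of_real \<rho>) 1 < d" using \<rho> by simp
  qed (use \<rho> in simp)
  then have "Re (eval_fps G 1) - Re (eval_fps G (of_real \<rho>)) \<le> e"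
    using complex_Re_le_cmod[of "eval_fps G 1 - eval_fps G (of_real \<rho>)"]
    by (simp add: dist_norm norm_minus_commute)
  then have "l1 (dilate \<rho> F - F) \<and> l1_norm (dilate \<rho> F - F) \<le> e"
    using l1_bound[OF b s] by auto
  then show ?thesis using \<rho> by blast
qed

text \<open>Wiener's lemma for power series. Let \<open>g > 0\<close> be the minimum of \<open>\<bar>f\<bar>\<close> on the closed disc, and
  replace \<open>f\<close> by \<open>f\<^sub>\<rho>(z) = f(\<rho> z)\<close> with \<open>\<rho> < 1\<close> so close to \<open>1\<close> that \<open>E = f\<^sub>\<rho> - f\<close> has norm at
  most \<open>g/2\<close>. For \<open>Q = 1/f\<^sub>\<rho>\<close> Cauchy's inequality gives \<open>\<parallel>Q\<^sup>N\<parallel> \<le> g\<^sup>-\<^sup>N / (1 - \<rho>)\<close>. Since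
  \<open>f Q = 1 - E Q\<close>, multiplication by the geometric sum of the powers of \<open>E Q\<close> below \<open>N\<close> turns
  \<open>f Q\<close> into \<open>1 - (E Q)\<^sup>N\<close>, where \<open>\<parallel>(E Q)\<^sup>N\<parallel> \<le> 2\<^sup>-\<^sup>N / (1 - \<rho>) < 1\<close> for large \<open>N\<close>, and this is
  invertible by the geometric series.\<close>

lemma l1_inverse:
  assumes F: "l1 F" and nz: "\<And>z. norm z \<le> 1 \<Longrightarrow> eval_fps F z \<noteq> 0"
  shows "l1 (inverse F)"
proof -
  have "continuous_on (cball 0 1) (\<lambda>z. norm (eval_fps F z))"
    by (intro continuous_on_norm continuous_on_eval_fps_l1[OF F])
  then have "\<exists>w\<in>cball 0 1. \<forall>z\<in>cball 0 1. norm (eval_fps F w) \<le> norm (eval_fps F z)"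
    by (intro continuous_attains_inf) auto
  then obtain w where w: "w \<in> cball 0 1"
      "\<And>z. z \<in> cball 0 1 \<Longrightarrow> norm (eval_fps F w) \<le> norm (eval_fps F z)"
    by blast
  define g where "g = norm (eval_fps F w)"
  have g: "0 < g" using nz[of w] w(1) by (simp add: g_def)
  have lower: "g \<le> norm (eval_fps F z)" if "norm z \<le> 1" for z
    using w(2)[of z] that by (simp add: g_def)
  have F0: "fps_nth F 0 \<noteq> 0" using nz[of 0] by (simp add: eval_fps_at_0)
  obtain \<rho> where \<rho>: "0 \<le> \<rho>" "\<rho> < 1" and E: "l1 (dilate \<rho> F - F)"
      "l1_norm (dilate \<rho> F - F) \<le> g / 2"
    using dilate_close[OF F, of "g / 2"] g by auto
  define E where "E = dilate \<rho> F - F"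
  define Q where "Q = dilate \<rho> (inverse F)"
  have "dilate \<rho> F * Q = 1"
    unfolding Q_def dilate_mult[symmetric] by (simp add: inverse_mult_eq_1' F0)
  then have FQ: "F * Q = 1 - E * Q" by (simp add: E_def algebra_simps)
  have Qpow: "l1 (Q ^ N)" "l1_norm (Q ^ N) \<le> (1 / g) ^ N * (1 / (1 - \<rho>))" for N
  proof -
    have s: "(\<lambda>k. (1 / g) ^ N * \<rho> ^ k) sums ((1 / g) ^ N * (1 / (1 - \<rho>)))"
      using \<rho> by (intro sums_mult geometric_sums) simp
    have b: "norm (fps_nth (Q ^ N) k) \<le> (1 / g) ^ N * \<rho> ^ k" for k
      unfolding Q_def dilate_power[symmetric] dilate_nth
      using mult_right_mono[OF norm_coeff_inverse_power_le[OF F g lower, of N k], of "\<rho> ^ k"] \<rho>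
      by (simp add: norm_mult norm_power mult.commute)
    show "l1 (Q ^ N)" "l1_norm (Q ^ N) \<le> (1 / g) ^ N * (1 / (1 - \<rho>))"
      using l1_bound[OF b s] by auto
  qed
  \<comment> \<open>\<open>E Q\<close> itself may have large norm, but the norms of its powers decay like \<open>2\<^sup>-\<^sup>N\<close>.\<close>
  obtain N where "(1 / 2 :: real) ^ N < 1 - \<rho>"
    using real_arch_pow_inv[of "1 - \<rho>" "1 / 2"] \<rho> by auto
  then have small: "(1 / 2 :: real) ^ N * (1 / (1 - \<rho>)) < 1"
    using \<rho> by (simp add: field_simps)
  define X where "X = (E * Q) ^ N"
  have EN: "l1 (E ^ N)" "l1_norm (E ^ N) \<le> (g / 2) ^ N"
  proof -
    have "l1_norm (E ^ N) \<le> l1_norm E ^ N" using l1_power[of E N] E(1) by (simp add: E_def)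
    also have "\<dots> \<le> (g / 2) ^ N"
      using E l1_norm_nonneg[OF E(1)] by (intro power_mono) (simp_all add: E_def)
    finally show "l1_norm (E ^ N) \<le> (g / 2) ^ N" .
    show "l1 (E ^ N)" using l1_power[of E N] E(1) by (simp add: E_def)
  qed
  have X: "l1 X" "l1_norm X < 1"
  proof -
    have "l1_norm X \<le> l1_norm (E ^ N) * l1_norm (Q ^ N)"
      unfolding X_def power_mult_distrib by (rule l1_mult(2)[OF EN(1) Qpow(1)])
    also have "\<dots> \<le> (g / 2) ^ N * ((1 / g) ^ N * (1 / (1 - \<rho>)))"
      using g by (intro mult_mono EN(2) Qpow(2) l1_norm_nonneg[OF Qpow(1)]) auto
    also have "\<dots> = (1 / 2) ^ N * (1 / (1 - \<rho>))"
      unfolding mult.assoc[symmetric] power_mult_distrib[symmetric] using g by simp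
    finally show "l1_norm X < 1" using small by linarith
    show "l1 X" unfolding X_def power_mult_distrib by (rule l1_mult(1)[OF EN(1) Qpow(1)])
  qed
  define S where "S = (\<Sum>i<N. (E * Q) ^ i)"
  have "F * (Q * S) = (1 - E * Q) * S" by (simp add: FQ[symmetric] mult.assoc)
  also have "\<dots> = 1 - X" unfolding S_def X_def by (rule one_diff_power_eq[symmetric])
  finally have "inverse F * (F * (Q * S)) * inverse (1 - X) = inverse F * (1 - X) * inverse (1 - X)"
    by simp
  moreover have "fps_nth (1 - X) 0 \<noteq> 0"
  proof -
    have "norm (fps_nth X 0) \<le> l1_norm X"
      unfolding l1_norm_def
      using sum_le_suminf[of "\<lambda>n. norm (fps_nth X n)" "{0}"] X(1) by (simp add: l1_def)
    then show ?thesis using X(2) by auto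
  qed
  ultimately have "inverse F = Q * S * inverse (1 - X)"
    using F0 by (simp add: mult.assoc[symmetric] inverse_mult_eq_1) (simp add: mult.assoc inverse_mult_eq_1')
  moreover have "l1 Q" using Qpow(1)[of 1] by simp
  moreover have "l1 S" unfolding S_def
    using E(1) l1_power l1_mult(1) \<open>l1 Q\<close> by (intro l1_sum) (simp add: E_def)
  ultimately show ?thesis
    by (simp add: l1_mult(1) l1_inverse_one_minus[OF X])
qed
lemma l1_const: "l1 (fps_const c)"
  unfolding l1_def by (rule summable_finite[of "{0}"]) auto

lemma norm_eval_fps_le:
  assumes "l1 F" "norm z \<le> 1"
  shows "norm (eval_fps F z) \<le> l1_norm F"
  unfolding eval_fps_def l1_norm_def
  using assms by (intro norm_suminf_le norm_mult_power_le) (simp_all add: l1_def)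

lemma dilate_const [simp]: "dilate \<rho> (fps_const c) = fps_const c"
  by (simp add: fps_eq_iff)

lemma eval_fps_dilate: "eval_fps (dilate \<rho> F) z = eval_fps F (of_real \<rho> * z)"
  by (simp add: eval_fps_def power_mult_distrib ac_simps)

section \<open>Tails of a nonnegative sequence\<close>

definition tail :: "(nat \<Rightarrow> real) \<Rightarrow> nat \<Rightarrow> real" where
  "tail a n = (\<Sum>k. a (k + Suc n))"

lemma tail_nonneg: "(\<And>n. 0 \<le> a n) \<Longrightarrow> summable a \<Longrightarrow> 0 \<le> tail a n"
  unfolding tail_def by (intro suminf_nonneg summable_ignore_initial_segment) auto

lemma tail_0: "summable a \<Longrightarrow> tail a 0 = suminf a - a 0"
  using suminf_split_head[of a] by (simp add: tail_def)

lemma tail_Suc: "summable a \<Longrightarrow> tail a (Suc n) = tail a n - a (Suc n)"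
  unfolding tail_def
  using suminf_split_head[OF summable_ignore_initial_segment[of a "Suc n"]] by simp

lemma summable_if_weighted:
  fixes a :: "nat \<Rightarrow> real"
  assumes "\<And>n. 0 \<le> a n" "1 < r" "summable (\<lambda>n. a n * r ^ n)"
  shows "summable a" "summable (\<lambda>n. real n * a n)"
proof -
  have n_le: "real n \<le> r ^ n / (r - 1)" for n
    using Bernoulli_inequality[of "r - 1" n] assms(2) by (simp add: field_simps)
  show "summable (\<lambda>n. real n * a n)"
  proof (rule summable_comparison_test'[where N = 0])
    show "summable (\<lambda>n. a n * r ^ n * (1 / (r - 1)))" by (rule summable_mult2[OF assms(3)])
    show "norm (real n * a n) \<le> a n * r ^ n * (1 / (r - 1))" for n
      using mult_right_mono[OF n_le[of n] assms(1)[of n]] assms(1)[of n] by (simp add: mult.commute)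
  qed
  show "summable a"
  proof (rule summable_comparison_test'[where N = 0, OF assms(3)])
    show "norm (a n) \<le> a n * r ^ n" for n
      using mult_left_mono[OF one_le_power[of r n] assms(1)[of n]] assms(1,2) by simp
  qed
qed

text \<open>Monotonicity of the weights allows them to be moved inside the tail sum, which leaves the
  remainder of a convergent series.\<close>

lemma tail_tendsto_0:
  fixes a w :: "nat \<Rightarrow> real"
  assumes "\<And>n. 0 \<le> a n" and "summable a" and "summable (\<lambda>n. w n * a n)"
    and "incseq w" and "\<And>n. 0 \<le> w n"
  shows "(\<lambda>n. w n * (\<Sum>k. a (k + n))) \<longlonglongrightarrow> 0"
proof (rule tendsto_sandwich)
  let ?f = "\<lambda>n. w n * a n"
  have s: "summable (\<lambda>k. a (k + n))" "summable (\<lambda>k. ?f (k + n))" for n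
    using assms(2,3) summable_ignore_initial_segment[of ?f n]
    by (auto intro: summable_ignore_initial_segment)
  show "\<forall>\<^sub>F n in sequentially. 0 \<le> w n * (\<Sum>k. a (k + n))"
    using assms(1,5) s by (intro always_eventually allI mult_nonneg_nonneg suminf_nonneg) auto
  show "\<forall>\<^sub>F n in sequentially. w n * (\<Sum>k. a (k + n)) \<le> (\<Sum>k. ?f (k + n))"
  proof (intro always_eventually allI)
    fix n
    have "w n * (\<Sum>k. a (k + n)) = (\<Sum>k. w n * a (k + n))" using s by (simp add: suminf_mult)
    also have "\<dots> \<le> (\<Sum>k. ?f (k + n))"
      using assms(1,4) s
      by (intro suminf_le summable_mult mult_right_mono) (auto simp: incseq_def)
    finally show "w n * (\<Sum>k. a (k + n)) \<le> (\<Sum>k. ?f (k + n))" .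
  qed
  show "(\<lambda>n. \<Sum>k. ?f (k + n)) \<longlonglongrightarrow> 0"
    using suminf_exist_split2[OF assms(3)] by simp
qed auto

text \<open>Both summation formulas below are exact summations by parts for the partial sums, with a boundary term
  that vanishes by the preceding lemma.\<close>

lemma tail_sums:
  assumes "\<And>n. 0 \<le> a n" "summable a" "summable (\<lambda>n. real n * a n)"
  shows "tail a sums (\<Sum>n. real n * a n)"
proof -
  have "(\<Sum>n<N. tail a n) = (\<Sum>n<N. real n * a n) + real N * (\<Sum>k. a (k + N))" for N
  proof (induction N)
    case (Suc N)
    have "(\<Sum>k. a (k + N)) = a N + tail a N"
      unfolding tail_def
      using suminf_split_head[OF summable_ignore_initial_segment[OF assms(2), of N]] by simp
    then show ?case
      using Suc by (simp add: tail_def algebra_simps)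
  qed simp
  moreover have "(\<lambda>N. real N * (\<Sum>k. a (k + N))) \<longlonglongrightarrow> 0"
    using assms by (intro tail_tendsto_0) (auto simp: incseq_def)
  ultimately show ?thesis
    using tendsto_add[OF summable_LIMSEQ[OF assms(3)]] by (fastforce simp: sums_def)
qed

lemma tail_sums_weighted:
  assumes "\<And>n. 0 \<le> a n" "1 < r" "summable (\<lambda>n. a n * r ^ n)"
  shows "(\<lambda>n. tail a n * r ^ n) sums (((\<Sum>n. a n * r ^ n) - (\<Sum>n. a n)) / (r - 1))"
proof -
  have a: "summable a" using summable_if_weighted[OF assms] by blast
  have "(r - 1) * (\<Sum>n<N. tail a n * r ^ n)
      = (\<Sum>n<N. a n * r ^ n) - (\<Sum>n. a n) + r ^ N * (\<Sum>k. a (k + N))" for N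
  proof (induction N)
    case (Suc N)
    have "(\<Sum>k. a (k + N)) = a N + tail a N"
      unfolding tail_def
      using suminf_split_head[OF summable_ignore_initial_segment[OF a, of N]] by simp
    then show ?case
      using Suc by (simp add: tail_def algebra_simps)
  qed simp
  moreover have "(\<lambda>N. r ^ N * (\<Sum>k. a (k + N))) \<longlonglongrightarrow> 0"
    using assms a by (intro tail_tendsto_0)
      (auto simp: mult.commute intro!: incseq_SucI mult_left_mono)
  then have "(\<lambda>N. (\<Sum>n<N. a n * r ^ n) - (\<Sum>n. a n) + r ^ N * (\<Sum>k. a (k + N)))
      \<longlonglongrightarrow> (\<Sum>n. a n * r ^ n) - (\<Sum>n. a n) + 0"
    by (intro tendsto_add tendsto_diff tendsto_const summable_LIMSEQ assms(3))
  ultimately have "(\<lambda>N. (r - 1) * (\<Sum>n<N. tail a n * r ^ n))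
      \<longlonglongrightarrow> (\<Sum>n. a n * r ^ n) - (\<Sum>n. a n)"
    by simp
  then have "(\<lambda>N. (r - 1) * (\<Sum>n<N. tail a n * r ^ n) / (r - 1))
      \<longlonglongrightarrow> ((\<Sum>n. a n * r ^ n) - (\<Sum>n. a n)) / (r - 1)"
    by (rule tendsto_divide) (use assms(2) in auto)
  then show ?thesis using assms(2) by (simp add: sums_def)
qed

section \<open>The function \<open>D\<close>\<close>

lemma dist_one_exp:
  assumes "0 \<le> x" "x \<le> 2 * pi"
  shows "cmod (1 - exp (\<i> * of_real x)) = 2 * sin (x / 2)"
proof -
  have "0 \<le> sin (x / 2)" using assms by (intro sin_ge_zero) auto
  then show ?thesis
    using dist_exp_i_1[of x] by (simp add: norm_minus_commute)
qed

lemma D_fun_closed_form: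
  fixes \<beta> x :: real
  assumes "0 \<le> \<beta>" "\<beta> < 1" "0 < x" "x \<le> pi"
  shows "D_fun \<beta> (pi / x - 1)
    = (sqrt (1 + \<beta> / (1 - \<beta>)\<^sup>2 * (2 * sin (x / 2))\<^sup>2) - 1) / (2 * sin (x / 2))"
proof -
  define \<kappa> where "\<kappa> = \<beta> / (1 - \<beta>)"
  let ?e = "exp (\<i> * of_real x)"
  have x: "pi / (1 + (pi / x - 1)) = x" using assms by simp
  have d: "cmod (1 - ?e) = 2 * sin (x / 2)" using assms by (intro dist_one_exp) auto
  have "(cmod (1 + of_real \<kappa> * (1 - ?e)))\<^sup>2 = (1 + \<kappa> * (1 - cos x))\<^sup>2 + (\<kappa> * sin x)\<^sup>2"
    by (simp add: cmod_power2 Re_exp Im_exp)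
  also have "\<dots> = 1 + 2 * (\<kappa> + \<kappa>\<^sup>2) * (1 - cos x)"
    using sin_cos_squared_add[of x] by algebra
  also have "1 - cos x = 2 * (sin (x / 2))\<^sup>2" using cos_double_sin[of "x / 2"] by simp
  also have "2 * (\<kappa> + \<kappa>\<^sup>2) * (2 * (sin (x / 2))\<^sup>2) = (\<kappa> + \<kappa>\<^sup>2) * (2 * sin (x / 2))\<^sup>2"
    by (simp add: power2_eq_square algebra_simps)
  also have "\<kappa> + \<kappa>\<^sup>2 = \<beta> / (1 - \<beta>)\<^sup>2"
  proof -
    have "1 + \<kappa> = 1 / (1 - \<beta>)" using assms by (simp add: \<kappa>_def field_simps)
    moreover have "\<kappa> + \<kappa>\<^sup>2 = \<kappa> * (1 + \<kappa>)" by (simp add: power2_eq_square algebra_simps)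
    ultimately show ?thesis by (simp add: \<kappa>_def power2_eq_square)
  qed
  finally have "cmod (1 + of_real \<kappa> * (1 - ?e))
      = sqrt (1 + \<beta> / (1 - \<beta>)\<^sup>2 * (2 * sin (x / 2))\<^sup>2)"
    by (metis norm_ge_zero real_sqrt_unique)
  then show ?thesis unfolding D_fun_def x d \<kappa>_def by simp
qed

text \<open>In terms of \<open>1/u\<close> the quotient is \<open>K / (1/u + sqrt (1/u\<^sup>2 + K))\<close>, from which the monotonicity
  can be read off.\<close>

lemma sqrt_slope_mono:
  fixes K s t :: real
  assumes "0 \<le> K" "0 < s" "s \<le> t"
  shows "(sqrt (1 + K * s\<^sup>2) - 1) / s \<le> (sqrt (1 + K * t\<^sup>2) - 1) / t"
proof -
  have eq: "(sqrt (1 + K * u\<^sup>2) - 1) / u = K / (1 / u + sqrt (1 / u\<^sup>2 + K))" if "0 < u" for u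
  proof -
    have "1 / u\<^sup>2 + K = (1 + K * u\<^sup>2) / u\<^sup>2" using that by (simp add: field_simps)
    then have "sqrt (1 / u\<^sup>2 + K) = sqrt (1 + K * u\<^sup>2) / u"
      using that by (simp only: real_sqrt_divide real_sqrt_abs abs_of_pos)
    then have "1 / u + sqrt (1 / u\<^sup>2 + K) = (1 + sqrt (1 + K * u\<^sup>2)) / u"
      by (simp add: add_divide_distrib)
    moreover have "(sqrt (1 + K * u\<^sup>2) - 1) * (sqrt (1 + K * u\<^sup>2) + 1) = K * u\<^sup>2"
      using assms(1) by (simp add: algebra_simps power2_eq_square[symmetric])
    moreover have "0 < sqrt (1 + K * u\<^sup>2) + 1" using assms(1) by (simp add: add_nonneg_pos)
    ultimately show ?thesis using that by (simp add: field_simps power2_eq_square)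
  qed
  have "1 / t \<le> 1 / s" using assms by (simp add: frac_le)
  moreover have "1 / t\<^sup>2 \<le> 1 / s\<^sup>2" using assms by (intro divide_left_mono power_mono) auto
  moreover have "0 < 1 / t + sqrt (1 / t\<^sup>2 + K)"
    using assms by (intro add_pos_nonneg) auto
  ultimately show ?thesis
    using assms by (simp add: eq)
      (intro divide_left_mono add_mono real_sqrt_le_mono; simp add: add_pos_nonneg)
qed

lemma D_fun_mono:
  assumes "0 \<le> \<beta>" "\<beta> < 1" "0 < x" "x \<le> y" "y \<le> pi"
  shows "D_fun \<beta> (pi / x - 1) \<le> D_fun \<beta> (pi / y - 1)"
proof -
  have "0 < sin (x / 2)" using assms by (intro sin_gt_zero) auto
  moreover have "sin (x / 2) \<le> sin (y / 2)" using assms by (intro sin_monotone_2pi_le) auto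
  ultimately show ?thesis
    using assms sqrt_slope_mono[of "\<beta> / (1 - \<beta>)\<^sup>2" "2 * sin (x / 2)" "2 * sin (y / 2)"]
    by (simp only: D_fun_closed_form) simp
qed

lemma D_fun_pos:
  assumes "0 < \<beta>" "\<beta> < 1" "0 < x" "x \<le> pi"
  shows "0 < D_fun \<beta> (pi / x - 1)"
proof -
  have "0 < sin (x / 2)" using assms by (intro sin_gt_zero) auto
  then show ?thesis using assms by (simp add: D_fun_closed_form)
qed

lemma D_fun_le:
  assumes "0 < \<beta>" "\<beta> < 1" "0 < x" "x \<le> pi"
  shows "(1 - \<beta>) * D_fun \<beta> (pi / x - 1) \<le> \<beta>"
proof -
  let ?e = "exp (\<i> * of_real x)" and ?k = "\<beta> / (1 - \<beta>)"
  have x: "pi / (1 + (pi / x - 1)) = x" using assms by simp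
  have "0 < sin (x / 2)" using assms by (intro sin_gt_zero) auto
  then have d: "0 < cmod (1 - ?e)" using dist_one_exp[of x] assms by simp
  have "cmod (1 + of_real ?k * (1 - ?e)) \<le> 1 + cmod (of_real ?k * (1 - ?e))"
    using norm_triangle_ineq[of 1 "of_real ?k * (1 - ?e)"] by simp
  also have "cmod (of_real ?k * (1 - ?e)) = ?k * cmod (1 - ?e)"
    using assms by (simp only: norm_mult norm_of_real) simp
  finally have "D_fun \<beta> (pi / x - 1) \<le> ?k"
    using d unfolding D_fun_def x by (simp add: pos_divide_le_eq)
  then show ?thesis using assms by (simp add: pos_le_divide_eq mult.commute)
qed

text \<open>The numerator of \<open>D\<close> is the distance from the point \<open>1 + (\<beta>/(1-\<beta>)) (1 - e\<^sup>i\<^sup>x)\<close> to the unit disc.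
  The angle \<open>\<sigma>\<close> describes the direction in which this distance is attained; for this direction
  it becomes linear in the point, which is the form needed to compare \<open>D\<close> with an average over
  the \<open>b\<^sub>n\<close>.\<close>

lemma D_fun_direction:
  fixes \<beta> x :: real
  assumes "0 < \<beta>" "\<beta> < 1" "0 < x" "x \<le> pi"
  shows "\<exists>\<sigma>. 0 \<le> \<sigma> \<and> \<sigma> \<le> pi / 2 \<and> (1 - \<beta>) * D_fun \<beta> (pi / x - 1)
    = sin \<sigma> - (1 - \<beta>) * (1 - cos (\<sigma> + x / 2)) / (2 * sin (x / 2))"
proof -
  define S C where "S = sin (x / 2)" and "C = cos (x / 2)"
  have S: "0 < S" unfolding S_def using assms by (intro sin_gt_zero) auto
  have C: "0 \<le> C" unfolding C_def using assms by (intro cos_ge_zero) auto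
  have SC: "S\<^sup>2 + C\<^sup>2 = 1" by (simp add: S_def C_def)
  \<comment> \<open>Up to the factor \<open>2 (1 - \<beta>) sin (x/2)\<close>, the numbers \<open>p\<close> and \<open>q\<close> are the real and imaginary part
    of \<open>\<beta>/(1-\<beta>) + 1/(1 - e\<^sup>i\<^sup>x)\<close>.\<close>
  define p q R where "p = (1 + \<beta>) * S" and "q = (1 - \<beta>) * C" and "R = sqrt (p\<^sup>2 + q\<^sup>2)"
  have p: "0 < p" and q: "0 \<le> q" using S C assms by (simp_all add: p_def q_def)
  have R: "0 < R" "R\<^sup>2 = p\<^sup>2 + q\<^sup>2" using p by (simp_all add: R_def add_pos_nonneg)
  have "(p / R)\<^sup>2 + (q / R)\<^sup>2 = 1"
    unfolding power_divide add_divide_distrib[symmetric] R(2)[symmetric] using R(1) by simp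
  then obtain \<sigma> where \<sigma>: "0 \<le> \<sigma>" "\<sigma> \<le> pi / 2" "q / R = cos \<sigma>" "p / R = sin \<sigma>"
    using sincos_total_pi_half[of "q / R" "p / R"] p q R by (auto simp: add.commute)
  have "p\<^sup>2 + q\<^sup>2 = (1 - \<beta>)\<^sup>2 + 4 * \<beta> * S\<^sup>2"
    unfolding p_def q_def using SC by algebra
  also have "\<dots> = (1 - \<beta>)\<^sup>2 * (1 + \<beta> / (1 - \<beta>)\<^sup>2 * (2 * S)\<^sup>2)"
    using assms by (simp add: field_simps)
  finally have R_eq: "R = (1 - \<beta>) * sqrt (1 + \<beta> / (1 - \<beta>)\<^sup>2 * (2 * S)\<^sup>2)"
    unfolding R_def using assms by (simp add: real_sqrt_mult)
  have "(1 - \<beta>) * D_fun \<beta> (pi / x - 1)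
      = (1 - \<beta>) * ((sqrt (1 + \<beta> / (1 - \<beta>)\<^sup>2 * (2 * S)\<^sup>2) - 1) / (2 * S))"
    using D_fun_closed_form[of \<beta> x] assms by (simp only: S_def)
  also have "\<dots> = (R - (1 - \<beta>)) / (2 * S)"
    unfolding R_eq by (simp only: right_diff_distrib times_divide_eq_right mult_1_right)
  finally have D: "(1 - \<beta>) * D_fun \<beta> (pi / x - 1) = (R - (1 - \<beta>)) / (2 * S)" .
  have "R = p * sin \<sigma> + q * cos \<sigma>"
    using R unfolding \<sigma>(3,4)[symmetric] by (simp add: field_simps power2_eq_square)
  then have "(R - (1 - \<beta>)) / (2 * S)
      = sin \<sigma> - (1 - \<beta>) * (1 - cos (\<sigma> + x / 2)) / (2 * S)"
    using S unfolding p_def q_def cos_add S_def[symmetric] C_def[symmetric]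
    by (simp add: field_simps)
  then show ?thesis using D \<sigma>(1,2) unfolding S_def by auto
qed
text \<open>Concavity of the sine on \<open>[0, \<pi>]\<close>, in the form that \<open>sin u / u\<close> decreases.\<close>

lemma sin_half_ratio_mono:
  fixes x y :: real
  assumes "0 < x" "x \<le> y" "y \<le> pi"
  shows "x * sin (y / 2) \<le> y * sin (x / 2)"
proof -
  have convex: "convex_on {0..pi} (\<lambda>u. - sin u)"
    by (rule f''_ge0_imp_convex[where f' = "\<lambda>u. - cos u" and f'' = sin])
      (auto intro!: derivative_eq_intros sin_ge_zero)
  have "- sin ((1 - x / y) * 0 + (x / y) * (y / 2)) \<le> (1 - x / y) * (- sin 0) + (x / y) * (- sin (y / 2))"
    using assms by (intro convex_onD[OF convex, of "x / y" 0 "y / 2", simplified real_scaleR_def]) auto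
  then have "(x / y) * sin (y / 2) \<le> sin (x / 2)" using assms by simp
  then show ?thesis using assms by (simp add: pos_divide_le_eq mult.commute)
qed

section \<open>The renewal equation for power series\<close>

locale exp_renewal =
  fixes b :: "nat \<Rightarrow> real" and r :: real
  assumes distribution: "pos_distribution b"
    and r: "1 < r"
    and summable_r: "summable (\<lambda>n. b (Suc n) * r ^ Suc n)"
begin

lemma b_nonneg: "0 \<le> b (Suc n)"
  using distribution by (simp add: pos_distribution_def)

lemma b_sums: "(\<lambda>n. b (Suc n)) sums 1"
  using distribution by (simp add: pos_distribution_def)

text \<open>The distribution as a sequence on all natural numbers; the value of \<open>b\<close> at \<open>0\<close> is arbitrary and has to
  be replaced by \<open>0\<close>.\<close>

definition p :: "nat \<Rightarrow> real" where
  "p n = (if n = 0 then 0 else b n)"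

lemma p_simps [simp]: "p 0 = 0" "p (Suc n) = b (Suc n)"
  by (simp_all add: p_def)

lemma p_nonneg: "0 \<le> p n"
  using b_nonneg by (cases n) simp_all

lemma p_weighted: "(\<lambda>n. p n * r ^ n) sums gen_fun b r"
proof -
  have "(\<lambda>n. p (Suc n) * r ^ Suc n) sums gen_fun b r"
    using summable_sums[OF summable_r] by (simp add: gen_fun_def)
  then show ?thesis by (subst (asm) sums_Suc_iff) simp
qed

lemma p_sums: "p sums 1"
proof -
  have "(\<lambda>n. p (Suc n)) sums 1" using b_sums by simp
  then show ?thesis by (subst (asm) sums_Suc_iff) simp
qed

lemma summable_n_p: "summable (\<lambda>n. real n * p n)"
  using summable_if_weighted[OF p_nonneg r sums_summable[OF p_weighted]] by blast

lemma summable_mean: "summable (\<lambda>n. real (Suc n) * b (Suc n))"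
  using summable_n_p by (subst (asm) summable_Suc_iff[symmetric]) simp

definition t :: "nat \<Rightarrow> real" where "t = tail p"

definition h :: "nat \<Rightarrow> real" where "h = tail t"

lemma t_nonneg: "0 \<le> t n"
  unfolding t_def by (rule tail_nonneg[OF p_nonneg sums_summable[OF p_sums]])

lemma t_0 [simp]: "t 0 = 1"
  using tail_0[OF sums_summable[OF p_sums]] p_sums by (simp add: t_def sums_iff)

lemma t_Suc: "t (Suc n) = t n - b (Suc n)"
  using tail_Suc[OF sums_summable[OF p_sums], of n] by (simp add: t_def)

lemma t_sums: "t sums mean b"
proof -
  have "mean b = (\<Sum>n. real n * p n)"
    using suminf_split_head[OF summable_n_p] by (simp add: mean_def)
  then show ?thesis
    unfolding t_def using tail_sums[OF p_nonneg sums_summable[OF p_sums] summable_n_p] by simp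
qed

lemma t_weighted: "(\<lambda>n. t n * r ^ n) sums c_fun b r"
  using tail_sums_weighted[OF p_nonneg r sums_summable[OF p_weighted]] p_weighted p_sums
  by (simp add: t_def c_fun_def sums_iff)

lemma mean_ge_1: "1 \<le> mean b"
  using sum_le_suminf[OF sums_summable[OF t_sums], of "{0}"] t_nonneg t_sums
  by (simp add: sums_iff)

lemma h_nonneg: "0 \<le> h n"
  unfolding h_def by (rule tail_nonneg[OF t_nonneg sums_summable[OF t_sums]])

lemma h_0: "h 0 = mean b - 1"
  using tail_0[OF sums_summable[OF t_sums]] t_sums by (simp add: h_def sums_iff)

lemma h_Suc: "h (Suc n) = h n - t (Suc n)"
  using tail_Suc[OF sums_summable[OF t_sums], of n] by (simp add: h_def)

lemma h_weighted: "(\<lambda>n. h n * r ^ n) sums ((c_fun b r - mean b) / (r - 1))"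
  using tail_sums_weighted[OF t_nonneg r sums_summable[OF t_weighted]] t_weighted t_sums
  by (simp add: h_def sums_iff)

definition C :: "complex fps" where "C = Abs_fps (\<lambda>n. of_real (t n))"

definition H :: "complex fps" where "H = Abs_fps (\<lambda>n. of_real (h n))"

definition W :: "complex fps" where
  "W = Abs_fps (\<lambda>n. of_real (renewal b n - 1 / mean b))"

text \<open>With \<open>U\<close> the generating function of the renewal sequence, the renewal equation reads
  \<open>(1 - z) C U = 1\<close>, while \<open>(1 - z) H = c(1) - C\<close> and \<open>(1 - z) W = (1 - z) U - 1/c(1)\<close>. Multiplying the
  last equation by \<open>c(1) C\<close> gives the claim up to the factor \<open>1 - z\<close>, which can be cancelled.\<close>

lemma fps_identity: "fps_const (of_real (mean b)) * C * W = H"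
proof -
  define U P where "U = Abs_fps (\<lambda>n. complex_of_real (renewal b n))"
    and "P = Abs_fps (\<lambda>n. complex_of_real (p n))"
  let ?M = "fps_const (complex_of_real (mean b))" and ?X = "fps_X :: complex fps"
  have "fps_nth U n = fps_nth (1 + P * U) n" for n
  proof (cases n)
    case (Suc m)
    have "(\<Sum>i=0..Suc m. p i * renewal b (Suc m - i)) = renewal b (Suc m)"
      by (subst sum.atLeast_Suc_atMost) (auto simp: p_def mult.commute intro!: sum.cong)
    then show ?thesis
      unfolding Suc by (simp add: U_def P_def fps_mult_nth flip: of_real_mult of_real_sum
          del: sum.atLeast0_atMost_Suc renewal.simps)
  qed (simp add: U_def P_def)
  then have "U = 1 + P * U" by (simp only: fps_eq_iff simp_thms)
  then have PU: "(1 - P) * U = 1" by (metis add_diff_cancel_right' left_diff_distrib mult_1)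
  have CP: "(1 - ?X) * C = 1 - P"
    unfolding fps_eq_iff
  proof
    show "fps_nth ((1 - ?X) * C) n = fps_nth (1 - P) n" for n
      by (cases n) (simp_all add: left_diff_distrib C_def P_def t_Suc)
  qed
  have HC: "(1 - ?X) * H = ?M - C"
    unfolding fps_eq_iff
  proof
    show "fps_nth ((1 - ?X) * H) n = fps_nth (?M - C) n" for n
      by (cases n) (simp_all add: left_diff_distrib C_def H_def h_Suc h_0)
  qed
  have WU: "(1 - ?X) * W = (1 - ?X) * U - fps_const (of_real (1 / mean b))"
    unfolding fps_eq_iff
  proof
    show "fps_nth ((1 - ?X) * W) n = fps_nth ((1 - ?X) * U - fps_const (of_real (1 / mean b))) n" for n
      by (cases n) (simp_all add: left_diff_distrib W_def U_def del: renewal.simps(2))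
  qed
  have MM: "?M * fps_const (of_real (1 / mean b)) = 1"
    using mean_ge_1 by (simp flip: of_real_mult)
  have "(1 - ?X) * (?M * C * W) = ?M * C * ((1 - ?X) * W)" by (simp only: ac_simps)
  also have "\<dots> = ?M * (((1 - ?X) * C) * U) - (?M * fps_const (of_real (1 / mean b))) * C"
    unfolding WU by (simp only: right_diff_distrib ac_simps)
  also have "\<dots> = (1 - ?X) * H" unfolding CP PU MM HC by simp
  finally have "(1 - ?X) * (?M * C * W) = (1 - ?X) * H" .
  moreover have "1 - ?X \<noteq> 0"
    by (metis fps_X_neq_one right_minus_eq)
  ultimately show ?thesis by (simp only: mult_cancel_left simp_thms)
qed

lemma norm_dilate_le:
  assumes "0 \<le> \<rho>" "\<rho> \<le> r" "\<And>n. 0 \<le> a n"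
  shows "norm (fps_nth (dilate \<rho> (Abs_fps (\<lambda>n. of_real (a n)))) n) \<le> a n * r ^ n"
proof -
  have "norm (fps_nth (dilate \<rho> (Abs_fps (\<lambda>n. of_real (a n)))) n) = a n * \<rho> ^ n"
    using assms by (simp add: norm_mult norm_power mult.commute)
  also have "\<dots> \<le> a n * r ^ n" using assms by (intro mult_left_mono power_mono)
  finally show ?thesis .
qed

lemma l1_dilate_C: "0 \<le> \<rho> \<Longrightarrow> \<rho> \<le> r \<Longrightarrow> l1 (dilate \<rho> C)"
  unfolding C_def by (rule l1_bound(1)[OF norm_dilate_le t_weighted]; use t_nonneg in blast)

lemma l1_dilate_H:
  assumes "0 \<le> \<rho>" "\<rho> \<le> r"
  shows "l1 (dilate \<rho> H)" "l1_norm (dilate \<rho> H) \<le> (c_fun b r - mean b) / (r - 1)"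
  unfolding H_def by (rule l1_bound[OF norm_dilate_le h_weighted]; use assms h_nonneg in blast)+

lemma l1_dilate_W:
  assumes \<rho>: "0 \<le> \<rho>" "\<rho> \<le> r" and nz: "\<And>z. norm z \<le> \<rho> \<Longrightarrow> eval_fps C z \<noteq> 0"
  shows "l1 (dilate \<rho> W)"
proof -
  let ?M = "fps_const (complex_of_real (mean b))" and ?C = "dilate \<rho> C"
  have inv: "l1 (inverse ?C)"
  proof (rule l1_inverse[OF l1_dilate_C[OF \<rho>]])
    show "eval_fps ?C z \<noteq> 0" if "norm z \<le> 1" for z
      unfolding eval_fps_dilate
      using that \<rho> by (intro nz) (simp add: norm_mult mult_left_le)
  qed
  have "fps_nth ?C 0 \<noteq> 0" by (simp add: C_def)
  then have CC: "inverse ?C * ?C = 1" by (rule inverse_mult_eq_1)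
  have "dilate \<rho> ?M * ?C * dilate \<rho> W = dilate \<rho> H"
    unfolding dilate_mult[symmetric] fps_identity ..
  then have MCW: "?M * ?C * dilate \<rho> W = dilate \<rho> H" by simp
  let ?K = "fps_const (complex_of_real (1 / mean b))"
  have KM: "?K * ?M = 1" using mean_ge_1 by (simp flip: of_real_mult)
  have "dilate \<rho> W = (?K * ?M) * (inverse ?C * ?C) * dilate \<rho> W"
    by (simp only: KM CC mult_1_left)
  also have "\<dots> = ?K * (inverse ?C * (?M * ?C * dilate \<rho> W))" by (simp only: ac_simps)
  finally have "dilate \<rho> W = ?K * (inverse ?C * dilate \<rho> H)" by (simp only: MCW)
  then show ?thesis
    using l1_mult(1) inv l1_dilate_H[OF \<rho>] l1_const by simp
qed

lemma norm_eval_W_le: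
  assumes W: "l1 (dilate r W)" and z: "norm z = r" and g: "0 < g" "g \<le> norm (eval_fps C z)"
  shows "norm (eval_fps W z) \<le> (c_fun b r - mean b) / (mean b * (r - 1) * g)"
proof -
  define w where "w = z / of_real r"
  have w: "norm w \<le> 1" "of_real r * w = z" using z r by (auto simp: w_def norm_divide)
  have r0: "0 \<le> r" "r \<le> r" using r by auto
  have "eval_fps (dilate r (fps_const (of_real (mean b)) * C * W)) w = eval_fps (dilate r H) w"
    by (simp only: fps_identity)
  then have "of_real (mean b) * eval_fps C z * eval_fps W z = eval_fps (dilate r H) w"
    unfolding dilate_mult
    using w by (simp add: eval_fps_mult_l1 l1_mult(1) l1_const l1_dilate_C[OF r0] W eval_fps_dilate)
  then have "mean b * norm (eval_fps C z) * norm (eval_fps W z) = norm (eval_fps (dilate r H) w)"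
    using mean_ge_1 by (metis abs_of_nonneg le_trans zero_le_one norm_mult norm_of_real order_trans)
  also have "\<dots> \<le> (c_fun b r - mean b) / (r - 1)"
    using norm_eval_fps_le[OF l1_dilate_H(1)[OF r0] w(1)] l1_dilate_H(2)[OF r0] by linarith
  finally have le: "mean b * norm (eval_fps C z) * norm (eval_fps W z)
      \<le> (c_fun b r - mean b) / (r - 1)" .
  have "norm (eval_fps W z) * (mean b * g)
      \<le> mean b * norm (eval_fps C z) * norm (eval_fps W z)"
  proof -
    have "g * (mean b * norm (eval_fps W z)) \<le> norm (eval_fps C z) * (mean b * norm (eval_fps W z))"
      using g mean_ge_1 by (intro mult_right_mono) auto
    then show ?thesis by (simp only: ac_simps)
  qed
  then have "norm (eval_fps W z) * (mean b * g) \<le> (c_fun b r - mean b) / (r - 1)"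
    using le by linarith
  then have "norm (eval_fps W z) \<le> (c_fun b r - mean b) / (r - 1) / (mean b * g)"
    using g mean_ge_1 by (subst pos_le_divide_eq) auto
  then show ?thesis by (simp add: ac_simps)
qed

lemma C_sums:
  assumes "norm z \<le> r"
  shows "(\<lambda>n. of_real (t n) * z ^ n) sums eval_fps C z"
proof -
  have "summable (\<lambda>n. of_real (t n) * z ^ n)"
  proof (rule summable_comparison_test'[where N = 0])
    show "summable (\<lambda>n. t n * r ^ n)" using t_weighted by (rule sums_summable)
    show "norm (of_real (t n) * z ^ n) \<le> t n * r ^ n" for n
      using assms t_nonneg[of n] by (simp add: norm_mult norm_power mult_left_mono power_mono)
  qed
  then show ?thesis by (simp add: eval_fps_def C_def summable_sums)
qed

lemma b_sums_eval:
  assumes "norm z \<le> r"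
  shows "(\<lambda>n. of_real (b (Suc n)) * z ^ Suc n) sums (1 - (1 - z) * eval_fps C z)"
proof -
  have "(\<lambda>n. of_real (t (Suc n)) * z ^ Suc n) sums (eval_fps C z - 1)"
    using sums_Suc_iff[of "\<lambda>n. of_real (t n) * z ^ n" "eval_fps C z - 1"] C_sums[OF assms] by simp
  moreover have "(\<lambda>n. z * (of_real (t n) * z ^ n)) sums (z * eval_fps C z)"
    by (rule sums_mult[OF C_sums[OF assms]])
  ultimately have "(\<lambda>n. z * (of_real (t n) * z ^ n) - of_real (t (Suc n)) * z ^ Suc n)
      sums (z * eval_fps C z - (eval_fps C z - 1))"
    by (intro sums_diff)
  then show ?thesis by (simp add: t_Suc algebra_simps)
qed

text \<open>A zero of \<open>c\<close> would be a solution of \<open>b(z) = 1\<close>, but \<open>\<bar>b(z)\<bar> \<le> \<bar>z\<bar>\<close>.\<close>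

lemma C_nonzero_inside:
  assumes "norm z < 1"
  shows "eval_fps C z \<noteq> 0"
proof
  assume "eval_fps C z = 0"
  then have s: "(\<lambda>n. of_real (b (Suc n)) * z ^ Suc n) sums 1"
    using b_sums_eval[of z] assms r by simp
  have "norm (\<Sum>n. of_real (b (Suc n)) * z ^ Suc n) \<le> (\<Sum>n. b (Suc n) * norm z)"
  proof (rule norm_suminf_le)
    show "summable (\<lambda>n. b (Suc n) * norm z)" using b_sums by (intro summable_mult2) (rule sums_summable)
    show "norm (of_real (b (Suc n)) * z ^ Suc n) \<le> b (Suc n) * norm z" for n
      using power_decreasing[of 1 "Suc n" "norm z"] assms b_nonneg[of n]
      by (simp add: norm_mult norm_power mult_left_mono mult_left_le)
  qed
  also have "\<dots> = norm z" using sums_mult2[OF b_sums, of "norm z"] by (simp add: sums_iff)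
  finally show False using s assms by (simp add: sums_iff)
qed

lemma eval_C_cnj:
  assumes "norm z \<le> r"
  shows "eval_fps C (cnj z) = cnj (eval_fps C z)"
  using C_sums[of "cnj z"] iffD2[OF sums_cnj C_sums[OF assms]] assms
  by (simp add: sums_iff)

lemma eval_C_1: "eval_fps C 1 = of_real (mean b)"
  using C_sums[of 1] sums_of_real[OF t_sums, where 'a = complex] r by (simp add: sums_iff)

section \<open>Lower bounds for \<open>c\<close>\<close>

text \<open>Multiplying \<open>1 - b(z) = (1 - z) c(z)\<close> at \<open>z = e\<^sup>i\<^sup>x\<close> by \<open>\<i> e\<^sup>i\<^sup>(\<^sup>\<sigma>\<^sup>-\<^sup>x\<^sup>/\<^sup>2\<^sup>)\<close> turns the factor \<open>1 - z\<close> into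
  \<open>2 sin (x/2) e\<^sup>i\<^sup>\<sigma>\<close>, and the imaginary part of the \<open>n\<close>-th summand into a difference of cosines.
  The sequence \<open>q\<close> is a budget for the weight on which this difference may be negative.\<close>

lemma circle_lower_bound:
  fixes x \<sigma> Q :: real and q :: "nat \<Rightarrow> real"
  assumes x: "0 < x" "x \<le> pi"
    and q: "\<And>n. - (1 - cos (\<sigma> + x / 2)) * q n
      \<le> b (Suc n) * (cos (\<sigma> + x / 2) - cos (\<sigma> + x / 2 + real n * x))"
    and Q: "q sums Q"
  shows "sin \<sigma> - (1 - cos (\<sigma> + x / 2)) * Q / (2 * sin (x / 2)) \<le> norm (eval_fps C (cis x))"
proof -
  let ?c = "eval_fps C (cis x)" and ?\<chi> = "\<sigma> + x / 2"
  let ?u = "\<i> * cis (\<sigma> - x / 2)"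
  have s: "0 < 2 * sin (x / 2)" using x by (simp add: sin_gt_zero)
  have "(\<lambda>n. ?u * (of_real (b (Suc n)) - of_real (b (Suc n)) * cis x ^ Suc n))
      sums (?u * (of_real 1 - (1 - (1 - cis x) * ?c)))"
    using r by (intro sums_mult sums_diff b_sums_eval sums_of_real b_sums) simp
  then have sums_u: "(\<lambda>n. Im (?u * (of_real (b (Suc n)) - of_real (b (Suc n)) * cis x ^ Suc n)))
      sums Im (?u * (1 - cis x) * ?c)"
    by (intro sums_Im) (simp add: mult.assoc)
  have u: "?u * (1 - cis x) = of_real (2 * sin (x / 2)) * cis \<sigma>"
  proof -
    have "cis (\<sigma> - x / 2) * cis x = cis (\<sigma> + x / 2)"
      unfolding cis_mult by (rule arg_cong[where f = cis]) simp
    then have "?u * (1 - cis x) = \<i> * (cis (\<sigma> - x / 2) - cis (\<sigma> + x / 2))"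
      by (simp add: right_diff_distrib mult.assoc)
    also have "\<dots> = of_real (2 * sin (x / 2)) * cis \<sigma>"
      by (simp add: complex_eq_iff cos_add cos_diff sin_add sin_diff)
    finally show ?thesis .
  qed
  have Im_u: "Im (?u * (of_real (b (Suc n)) - of_real (b (Suc n)) * cis x ^ Suc n))
      = b (Suc n) * (cos (\<sigma> - x / 2) - cos (?\<chi> + real n * x))" for n
  proof -
    have "cis (\<sigma> - x / 2) * cis x ^ Suc n = cis (?\<chi> + real n * x)"
    proof -
      have "\<sigma> - x / 2 + real (Suc n) * x = ?\<chi> + real n * x" by (simp add: field_simps)
      then show ?thesis by (simp only: Complex.DeMoivre cis_mult)
    qed
    then have eq: "?u * (of_real (b (Suc n)) - of_real (b (Suc n)) * cis x ^ Suc n)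
        = \<i> * (of_real (b (Suc n)) * (cis (\<sigma> - x / 2) - cis (?\<chi> + real n * x)))"
      by (simp only: right_diff_distrib ac_simps)
    show ?thesis unfolding eq by simp
  qed
  have "Im (of_real (2 * sin (x / 2)) * cis \<sigma> * ?c) = 2 * sin (x / 2) * Im (cis \<sigma> * ?c)"
    by (simp add: algebra_simps)
  then have "(\<lambda>n. b (Suc n) * (cos (\<sigma> - x / 2) - cos (?\<chi> + real n * x)))
      sums (2 * sin (x / 2) * Im (cis \<sigma> * ?c))"
    using sums_u by (simp only: u Im_u)
  then have "(\<lambda>n. b (Suc n) * (cos (\<sigma> - x / 2) - cos (?\<chi> + real n * x))
        - b (Suc n) * (cos (\<sigma> - x / 2) - cos ?\<chi>))
      sums (2 * sin (x / 2) * Im (cis \<sigma> * ?c) - 1 * (cos (\<sigma> - x / 2) - cos ?\<chi>))"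
    by (intro sums_diff sums_mult2 b_sums)
  moreover have "cos (\<sigma> - x / 2) - cos ?\<chi> = 2 * sin (x / 2) * sin \<sigma>"
    by (simp add: cos_add cos_diff)
  ultimately have "(\<lambda>n. b (Suc n) * (cos ?\<chi> - cos (?\<chi> + real n * x)))
      sums (2 * sin (x / 2) * (Im (cis \<sigma> * ?c) - sin \<sigma>))"
    by (simp add: algebra_simps)
  then have "- (1 - cos ?\<chi>) * Q \<le> 2 * sin (x / 2) * (Im (cis \<sigma> * ?c) - sin \<sigma>)"
    using sums_le[OF q sums_mult[OF Q]] by blast
  also have "\<dots> \<le> 2 * sin (x / 2) * (norm ?c - sin \<sigma>)"
    using s abs_Im_le_cmod[of "cis \<sigma> * ?c"] by (intro mult_left_mono) (auto simp: norm_mult)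
  finally have "(sin \<sigma> - norm ?c) * (2 * sin (x / 2)) \<le> (1 - cos ?\<chi>) * Q"
    by (simp add: algebra_simps)
  then have "sin \<sigma> - norm ?c \<le> (1 - cos ?\<chi>) * Q / (2 * sin (x / 2))"
    using s by (simp only: pos_le_divide_eq)
  then show ?thesis by simp
qed

text \<open>For \<open>y \<le> x\<close> every summand except the first is charged with its full weight, and the angle \<open>\<sigma>\<close>
  is optimal for \<open>x\<close>. For \<open>x < y\<close> the angle that is optimal for \<open>y\<close> is used, and the \<open>n\<close>-th summand
  (counted from \<open>0\<close>) is charged with its weight times \<open>n x / (\<pi> - y)\<close>, as in Markov's inequality.
  The total charge is \<open>(c(1) - 1) x / (\<pi> - y) = (1 - \<beta>) x / y\<close> by the choice of \<open>y\<close>, and the factor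
  \<open>x / y\<close> compensates exactly for replacing \<open>sin (y/2)\<close> by \<open>sin (x/2)\<close> in the denominator.\<close>

lemma circle_bound_upper_half:
  fixes \<beta> x :: real
  assumes \<beta>: "0 < \<beta>" "\<beta> < 1" "\<beta> \<le> b 1" and x: "0 < x" "x \<le> pi"
  shows "(1 - \<beta>) * D_fun \<beta> (alpha b \<beta>) \<le> norm (eval_fps C (cis x))"
proof -
  define a where "a = alpha b \<beta>"
  define y where "y = pi / (1 + a)"
  have a0: "0 \<le> a" unfolding a_def alpha_def using mean_ge_1 \<beta> by simp
  have mean: "mean b - 1 = (1 - \<beta>) * a" unfolding a_def alpha_def using \<beta> by simp
  have y: "0 < y" "y \<le> pi" unfolding y_def using a0 by (simp_all add: pos_divide_le_eq)
  have a_y: "alpha b \<beta> = pi / y - 1" unfolding y_def using a0 by (simp add: a_def)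
  show ?thesis
  proof (cases "y \<le> x")
    case True
    obtain \<sigma> where \<sigma>: "(1 - \<beta>) * D_fun \<beta> (pi / x - 1)
        = sin \<sigma> - (1 - \<beta>) * (1 - cos (\<sigma> + x / 2)) / (2 * sin (x / 2))"
      using D_fun_direction[OF \<beta>(1,2) x] by blast
    define q where "q n = (if n = 0 then 0 else b (Suc n))" for n
    have "(\<lambda>n. b (Suc (Suc n))) sums (1 - b 1)"
      using sums_Suc_iff[of "\<lambda>n. b (Suc n)" "1 - b 1"] b_sums by simp
    then have "q sums (1 - b 1)"
      using sums_Suc_iff[of q "1 - b 1"] by (simp add: q_def)
    moreover have "- (1 - cos (\<sigma> + x / 2)) * q n
        \<le> b (Suc n) * (cos (\<sigma> + x / 2) - cos (\<sigma> + x / 2 + real n * x))" for n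
      using mult_left_mono[OF cos_le_one[of "\<sigma> + x / 2 + real n * x"] b_nonneg[of n]]
      by (simp add: q_def algebra_simps)
    ultimately have "sin \<sigma> - (1 - cos (\<sigma> + x / 2)) * (1 - b 1) / (2 * sin (x / 2))
        \<le> norm (eval_fps C (cis x))"
      by (intro circle_lower_bound[OF x])
    moreover have "(1 - cos (\<sigma> + x / 2)) * (1 - b 1) / (2 * sin (x / 2))
        \<le> (1 - \<beta>) * (1 - cos (\<sigma> + x / 2)) / (2 * sin (x / 2))"
      using \<beta>(3) x by (subst mult.commute[of "1 - \<beta>"])
        (intro divide_right_mono mult_left_mono, auto simp: sin_ge_zero)
    moreover have "(1 - \<beta>) * D_fun \<beta> (alpha b \<beta>) \<le> (1 - \<beta>) * D_fun \<beta> (pi / x - 1)"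
      unfolding a_y using \<beta> x y True by (intro mult_left_mono D_fun_mono) auto
    ultimately show ?thesis using \<sigma> by linarith
  next
    case False
    then have xy: "x < y" by simp
    show ?thesis
    proof (cases "a = 0")
      case True
      \<comment> \<open>The distribution is concentrated at \<open>1\<close>; then \<open>y = \<pi>\<close> and the Markov bound degenerates.\<close>
      then have t1: "t sums 1" using mean t_sums by simp
      have "(\<lambda>n. t (Suc n)) sums 0"
        using sums_Suc_iff[of t 0] t1 by simp
      then have "t (Suc n) = 0" for n
        using t_nonneg suminf_eq_zero_iff[of "\<lambda>n. t (Suc n)"] by (simp add: sums_iff)
      then have "(\<lambda>n. of_real (t (Suc n)) * cis x ^ Suc n) sums (0::complex)" by simp
      then have "(\<lambda>n. of_real (t n) * cis x ^ n) sums (1::complex)"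
        using sums_Suc_iff[of "\<lambda>n. of_real (t n) * cis x ^ n" "0::complex"] by simp
      then have "eval_fps C (cis x) = 1" using C_sums[of "cis x"] r by (simp add: sums_iff)
      then show ?thesis
        using D_fun_le[OF \<beta>(1,2) y] \<beta> unfolding a_y by simp
    next
      case False
      then have a: "0 < a" using a0 by simp
      have gap: "pi - y = pi * a / (1 + a)" unfolding y_def using a by (simp add: field_simps)
      then have gap0: "0 < pi - y" using a by simp
      obtain \<sigma> where \<sigma>: "0 \<le> \<sigma>" "\<sigma> \<le> pi / 2" "(1 - \<beta>) * D_fun \<beta> (pi / y - 1)
          = sin \<sigma> - (1 - \<beta>) * (1 - cos (\<sigma> + y / 2)) / (2 * sin (y / 2))"
        using D_fun_direction[OF \<beta>(1,2) y] by blast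
      let ?\<chi> = "\<sigma> + x / 2"
      define q where "q n = real n * b (Suc n) * (x / (pi - y))" for n
      have "(\<lambda>n. real (Suc n) * b (Suc n) - b (Suc n)) sums (mean b - 1)"
        unfolding mean_def by (intro sums_diff b_sums summable_sums summable_mean)
      then have "(\<lambda>n. real n * b (Suc n)) sums (mean b - 1)" by (simp add: algebra_simps)
      then have "q sums ((mean b - 1) * (x / (pi - y)))" unfolding q_def by (rule sums_mult2)
      moreover have "(mean b - 1) * (x / (pi - y)) = (1 - \<beta>) * (x / y)"
        unfolding mean gap y_def using a by (simp add: field_simps)
      ultimately have Q: "q sums ((1 - \<beta>) * (x / y))" by simp
      have q: "- (1 - cos ?\<chi>) * q n \<le> b (Suc n) * (cos ?\<chi> - cos (?\<chi> + real n * x))" for n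
      proof (cases "real n * x \<le> pi - y")
        case True
        \<comment> \<open>Up to the point \<open>2 \<pi> - \<chi>\<close> the cosine stays below its value at \<open>\<chi>\<close>, and
          \<open>2 \<chi> + n x \<le> 2 \<pi>\<close> because \<open>2 \<sigma> \<le> \<pi>\<close> and \<open>x < y\<close>.\<close>
        have "0 \<le> 2 * sin (?\<chi> + real n * x / 2) * sin (real n * x / 2)"
          using True \<sigma> x xy y by (intro mult_nonneg_nonneg sin_ge_zero) auto
        also have "\<dots> = cos ?\<chi> - cos (?\<chi> + real n * x)"
        proof -
          have "cos ?\<chi> - cos (?\<chi> + real n * x)
              = 2 * sin ((?\<chi> + (?\<chi> + real n * x)) / 2) * sin ((?\<chi> + real n * x - ?\<chi>) / 2)"
            by (rule cos_diff_cos)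
          then show ?thesis by (simp add: add_divide_distrib algebra_simps)
        qed
        finally have "0 \<le> b (Suc n) * (cos ?\<chi> - cos (?\<chi> + real n * x))"
          using b_nonneg[of n] by simp
        moreover have "0 \<le> (1 - cos ?\<chi>) * q n"
          unfolding q_def using b_nonneg[of n] x gap0 by simp
        ultimately show ?thesis by linarith
      next
        case False
        then have "1 \<le> real n * x / (pi - y)" using gap0 by (simp add: pos_le_divide_eq)
        then have "b (Suc n) \<le> q n"
          unfolding q_def using mult_left_mono[OF _ b_nonneg[of n], of 1 "real n * x / (pi - y)"]
          by (simp add: ac_simps)
        then have "(1 - cos ?\<chi>) * b (Suc n) \<le> (1 - cos ?\<chi>) * q n"
          by (intro mult_left_mono) auto
        moreover have "b (Suc n) * cos (?\<chi> + real n * x) \<le> b (Suc n)"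
          using mult_left_mono[OF cos_le_one b_nonneg[of n]] by simp
        ultimately show ?thesis by (simp add: algebra_simps)
      qed
      have sx: "0 < sin (x / 2)" and sy: "0 < sin (y / 2)"
        using x y by (auto intro!: sin_gt_zero)
      have cos: "1 - cos ?\<chi> \<le> 1 - cos (\<sigma> + y / 2)"
        using \<sigma> x y xy by (simp add: cos_mono_le_eq)
      have "(x / y) / (2 * sin (x / 2)) \<le> 1 / (2 * sin (y / 2))"
        using sin_half_ratio_mono[of x y] x y xy sx sy by (simp add: field_simps)
      then have "(1 - cos ?\<chi>) * ((x / y) / (2 * sin (x / 2)))
          \<le> (1 - cos (\<sigma> + y / 2)) * (1 / (2 * sin (y / 2)))"
        using x y sx by (intro mult_mono cos) auto
      then have "(1 - \<beta>) * ((1 - cos ?\<chi>) * ((x / y) / (2 * sin (x / 2))))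
          \<le> (1 - \<beta>) * ((1 - cos (\<sigma> + y / 2)) * (1 / (2 * sin (y / 2))))"
        using \<beta> by (intro mult_left_mono) auto
      then have "(1 - cos ?\<chi>) * ((1 - \<beta>) * (x / y)) / (2 * sin (x / 2))
          \<le> (1 - \<beta>) * (1 - cos (\<sigma> + y / 2)) / (2 * sin (y / 2))"
        by (simp add: ac_simps)
      then show ?thesis
        using circle_lower_bound[OF x q Q] \<sigma>(3) unfolding a_y by linarith
    qed
  qed
qed

lemma alpha_form:
  assumes "\<beta> < 1"
  obtains y where "0 < y" "y \<le> pi" "alpha b \<beta> = pi / y - 1"
proof
  have a0: "0 \<le> alpha b \<beta>" unfolding alpha_def using mean_ge_1 assms by simp
  show "0 < pi / (1 + alpha b \<beta>)" "pi / (1 + alpha b \<beta>) \<le> pi"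
    "alpha b \<beta> = pi / (pi / (1 + alpha b \<beta>)) - 1"
    using a0 by (simp_all add: pos_divide_le_eq)
qed

lemma circle_bound:
  assumes \<beta>: "0 < \<beta>" "\<beta> < 1" "\<beta> \<le> b 1" and w: "norm w = 1"
  shows "(1 - \<beta>) * D_fun \<beta> (alpha b \<beta>) \<le> norm (eval_fps C w)"
proof -
  obtain y where y: "0 < y" "y \<le> pi" "alpha b \<beta> = pi / y - 1"
    using alpha_form[OF \<beta>(2)] by blast
  have "w \<noteq> 0" using w by auto
  then have w_cis: "w = cis (Arg w)" using w cis_Arg[of w] by (simp add: sgn_eq)
  consider "Arg w = 0" | "0 < Arg w" | "Arg w < 0" by linarith
  then show ?thesis
  proof cases
    case 1
    then have "w = 1" using w_cis by simp
    then show ?thesis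
      using D_fun_le[OF \<beta>(1,2) y(1,2)] \<beta>(2) mean_ge_1 unfolding y(3) by (simp add: eval_C_1)
  next
    case 2
    then show ?thesis
      using circle_bound_upper_half[OF \<beta>, of "Arg w"] Arg_le_pi[of w] w_cis by simp
  next
    case 3
    have "w = cnj (cis (- Arg w))" using w_cis by (simp add: cis_cnj)
    then have "norm (eval_fps C w) = norm (eval_fps C (cis (- Arg w)))"
      using eval_C_cnj[of "cis (- Arg w)"] r by simp
    then show ?thesis
      using circle_bound_upper_half[OF \<beta>, of "- Arg w"] mpi_less_Arg[of w] 3 by simp
  qed
qed

text \<open>Compare \<open>c(z)\<close> with its value at the radial projection \<open>w\<close> of \<open>z\<close> to the unit circle: the difference is
  \<open>\<Sum> t\<^sub>n (\<bar>z\<bar>\<^sup>n - 1) w\<^sup>n\<close>.\<close>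

lemma annulus_bound:
  assumes \<beta>: "0 < \<beta>" "\<beta> < 1" "\<beta> \<le> b 1" and z: "1 \<le> norm z" "norm z \<le> r"
  shows "(1 - \<beta>) * D_fun \<beta> (alpha b \<beta>) - c_fun b r + mean b \<le> norm (eval_fps C z)"
proof -
  define w where "w = z / of_real (norm z)"
  have w: "norm w = 1" "z = of_real (norm z) * w" using z(1) by (auto simp: w_def norm_divide)
  have s: "(\<lambda>n. of_real (t n) * z ^ n - of_real (t n) * w ^ n) sums (eval_fps C z - eval_fps C w)"
    using z(2) w(1) r by (intro sums_diff C_sums) auto
  have m: "(\<lambda>n. t n * r ^ n - t n) sums (c_fun b r - mean b)"
    by (intro sums_diff t_weighted t_sums)
  have le: "norm (of_real (t n) * z ^ n - of_real (t n) * w ^ n) \<le> t n * r ^ n - t n" for n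
  proof -
    have "of_real (t n) * z ^ n - of_real (t n) * w ^ n
        = of_real (t n * (norm z ^ n - 1)) * w ^ n"
      by (subst w(2)) (simp add: algebra_simps power_mult_distrib)
    then have "norm (of_real (t n) * z ^ n - of_real (t n) * w ^ n) = \<bar>t n * (norm z ^ n - 1)\<bar>"
      by (simp only: norm_mult norm_of_real norm_power w(1)) simp
    also have "\<dots> = t n * (norm z ^ n - 1)" using t_nonneg[of n] z(1) by simp
    also have "\<dots> \<le> t n * (r ^ n - 1)"
      using t_nonneg[of n] z by (intro mult_left_mono diff_right_mono power_mono) auto
    finally show ?thesis by (simp add: right_diff_distrib)
  qed
  have "norm (eval_fps C z - eval_fps C w) \<le> c_fun b r - mean b"
    using norm_suminf_le[OF le sums_summable[OF m]] s m by (simp add: sums_iff)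
  then have "norm (eval_fps C w) \<le> norm (eval_fps C z) + (c_fun b r - mean b)"
    using norm_triangle_ineq2[of "eval_fps C w" "eval_fps C z"] by (simp add: norm_minus_commute)
  then show ?thesis using circle_bound[OF \<beta> w(1)] by linarith
qed

lemma summable_W:
  assumes "l1 (dilate \<rho> W)" "norm z = \<rho>"
  shows "summable (\<lambda>n. complex_of_real (renewal b n - 1 / mean b) * z ^ n)"
  by (rule summable_norm_cancel)
    (use assms(1)[unfolded assms(2)[symmetric]] in
      \<open>simp add: l1_def W_def norm_mult norm_power mult.commute\<close>)

section \<open>The limit and the bound\<close>

lemma renewal_limit:
  assumes \<beta>: "0 < \<beta>" "\<beta> < 1" "\<beta> \<le> b 1"
  shows "renewal b \<longlonglongrightarrow> inverse (mean b)"
proof -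
  obtain y where y: "0 < y" "y \<le> pi" "alpha b \<beta> = pi / y - 1"
    using alpha_form[OF \<beta>(2)] by blast
  have D: "0 < (1 - \<beta>) * D_fun \<beta> (alpha b \<beta>)"
    unfolding y(3) using D_fun_pos[OF \<beta>(1,2) y(1,2)] \<beta>(2) by simp
  have "l1 (dilate 1 W)"
  proof (rule l1_dilate_W)
    show "eval_fps C z \<noteq> 0" if "norm z \<le> 1" for z
      using that C_nonzero_inside[of z] circle_bound[OF \<beta>, of z] D by (cases "norm z = 1") auto
  qed (use r in auto)
  then have "summable (\<lambda>n. complex_of_real (renewal b n - 1 / mean b) * 1 ^ n)"
    by (rule summable_W) simp
  then have "(\<lambda>n. complex_of_real (renewal b n - 1 / mean b)) \<longlonglongrightarrow> 0"
    using summable_LIMSEQ_zero by fastforce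
  then have "(\<lambda>n. renewal b n - 1 / mean b) \<longlonglongrightarrow> 0"
    by (metis of_real_0 tendsto_of_real_iff)
  then have "(\<lambda>n. renewal b n - 1 / mean b + 1 / mean b) \<longlonglongrightarrow> 0 + 1 / mean b"
    by (intro tendsto_add tendsto_const)
  then show ?thesis by (simp add: inverse_eq_divide)
qed

lemma gap_imp_l1:
  assumes \<beta>: "0 < \<beta>" "\<beta> < 1" "\<beta> \<le> b 1" and gap: "0 < gap b \<beta> r"
  shows "l1 (dilate r W)"
proof (rule l1_dilate_W)
  show "eval_fps C z \<noteq> 0" if "norm z \<le> r" for z
  proof (cases "norm z < 1")
    case True
    then show ?thesis by (rule C_nonzero_inside)
  next
    case False
    then show ?thesis using annulus_bound[OF \<beta>, of z] that gap by (auto simp: gap_def)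
  qed
qed (use r in auto)

end

theorem theorem2p8:
  fixes b :: "nat \<Rightarrow> real" and \<beta> r :: real
  assumes "pos_distribution b"
    and "0 < \<beta>" and "\<beta> < 1" and "\<beta> \<le> b 1"
    and "1 < r" and "summable (\<lambda>n. b (Suc n) * r ^ Suc n)"
  shows "summable (\<lambda>n. real (Suc n) * b (Suc n))
    \<and> convergent (renewal b)
    \<and> lim (renewal b) = inverse (mean b)
    \<and> (gap b \<beta> r > 0 \<longrightarrow>
        (\<forall>z\<in>sphere (0::complex) r.
          summable (\<lambda>n. of_real (renewal b n - lim (renewal b)) * z ^ n)))
    \<and> (SUP z\<in>sphere (0::complex) r.
          ereal (cmod (\<Sum>n. of_real (renewal b n - lim (renewal b)) * z ^ n)))
        \<le> renewal_bound b \<beta> r"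
proof -
  interpret exp_renewal b r by unfold_locales (use assms in auto)
  note \<beta> = assms(2-4)
  have limit: "renewal b \<longlonglongrightarrow> inverse (mean b)" by (rule renewal_limit[OF \<beta>])
  then have lim: "lim (renewal b) = 1 / mean b" by (simp add: limI inverse_eq_divide)
  have "summable (\<lambda>n. of_real (renewal b n - lim (renewal b)) * z ^ n)"
    if "gap b \<beta> r > 0" "z \<in> sphere 0 r" for z :: complex
    unfolding lim by (rule summable_W[OF gap_imp_l1[OF \<beta> that(1)]]) (use that(2) in simp)
  moreover have "(SUP z\<in>sphere (0::complex) r.
      ereal (cmod (\<Sum>n. of_real (renewal b n - lim (renewal b)) * z ^ n))) \<le> renewal_bound b \<beta> r"
  proof (cases "gap b \<beta> r = 0")
    case True
    then show ?thesis by (simp add: renewal_bound_def)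
  next
    case False
    then have gap: "0 < gap b \<beta> r" by (simp add: gap_def max_def split: if_splits)
    show ?thesis
    proof (rule SUP_least)
      fix z :: complex assume "z \<in> sphere 0 r"
      then have z: "norm z = r" by simp
      have "gap b \<beta> r \<le> norm (eval_fps C z)"
        using annulus_bound[OF \<beta>, of z] z r by (simp add: gap_def)
      then have "norm (eval_fps W z)
          \<le> (c_fun b r - mean b) / (mean b * (r - 1) * gap b \<beta> r)"
        by (rule norm_eval_W_le[OF gap_imp_l1[OF \<beta> gap] z gap])
      then show "ereal (cmod (\<Sum>n. of_real (renewal b n - lim (renewal b)) * z ^ n))
          \<le> renewal_bound b \<beta> r"
        using False by (simp add: lim renewal_bound_def eval_fps_def W_def)
    qed
  qed
  ultimately show ?thesis
    using summable_mean limit lim by (auto simp: convergent_def inverse_eq_divide)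
qed

end
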